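(* Let $g:S\to F^*$ be a function such that $\mathcal{H}=\{u/g(u)\mid u\in S\}\cup\{0\}$ is a hyperoval in $K$, and let $s\in S$. Let $$\mathcal{O}_s=\left\{\frac{v}{g(v)}+\frac{s}{g(s)}\ \Big|\ v\in S,\ v\neq s\right\}\cup\left\{\frac{s}{g(s)}\right\},$$ which is an oval whose nucleus is the origin. Then the Niho bent function $f_s:K\to\mathbb{F}_2$ associated with $\mathcal{O}_s$ is $$f_s(x)=\sum_{j=0}^{m-1}\sum_{i=0}^{q}\left(\frac{g(s)^{2^j}}{s^{i(q-1)+2^j}}+\sum_{v\in S,\,v\neq s}\frac{g(s)^{2^j}g(v)^{2^j}}{(g(s)v+sg(v))^{i(q-1)+2^j}}\right)x^{i(q-1)+2^j}.$$
   Context: $F=\mathbb{F}_{q}$ with $q=2^m$, $K=\mathbb{F}_{q^2}\supset F$, $\bar{x}=x^q$, $S=\{u\in K: u\bar u=1\}$, and $tr$ is the trace from $F$ to $\mathbb{F}_2$. Every $x\in K^*$ is uniquely $x=\lambda u$ with $\lambda\in F^*$, $u\in S$. $K$, a two-dimensional $F$-vector space, is regarded as the point set of the affine plane $AG(2,q)$, embedded in its projective completion $PG(2,q)$; the origin is $0\in K$. An oval (resp. hyperoval) in $PG(2,q)$ is a set of $q+1$ (resp. $q+2$) points, no three collinear; all tangent lines of an oval meet in one point, its nucleus. A hyperoval (or oval) in $K$ is one all of whose points lie in $K$. An oval $\mathcal{O}\subset K$ with nucleus the origin can be written as $\{u/\gamma(u)\mid u\in S\}$ for a unique $\gamma:S\to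 F^*$; the Niho bent function associated with $\mathcal{O}$ is the Boolean function $f:K\to\mathbb{F}_2$ with $f(\lambda u)=tr(\lambda\gamma(u))$ for $\lambda\in F$, $u\in S$ (it is known to be bent). *)

theory Defs
  imports "HOL-Library.FuncSet" "HOL-Library.Cardinality" "HOL-Computational_Algebra.Primes"
begin

text \<open>The field \<open>K\<close> is the whole type \<open>'k\<close>; \<open>F\<close> is a subfield of it, given as a set.
  In all definitions \<open>q\<close> is \<open>card F\<close>, and \<open>K\<close> is regarded as an \<open>F\<close>-vector space, which is
  the affine plane \<open>AG(2,q)\<close> when \<open>K\<close> has \<open>q\<^sup>2\<close> elements.\<close>

definition is_subfield :: "'k::field set \<Rightarrow> bool" where
  "is_subfield F \<longleftrightarrow> 0 \<in> F \<and> 1 \<in> F \<and>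
     (\<forall>x\<in>F. \<forall>y\<in>F. x + y \<in> F \<and> x * y \<in> F) \<and>
     (\<forall>x\<in>F. - x \<in> F \<and> inverse x \<in> F)"

definition bar :: "'k::field set \<Rightarrow> 'k \<Rightarrow> 'k" where
  "bar F x = x ^ card F"

definition unit_circle :: "'k::field set \<Rightarrow> 'k set" where
  "unit_circle F = {u. u * bar F u = 1}"

text \<open>The trace from a field with \<open>2^m\<close> elements to its prime field. The prime field of order two
  is identified with the subset \<open>{0, 1}\<close> of \<open>K\<close>, so that Boolean functions on \<open>K\<close> become
  functions \<open>K \<Rightarrow> K\<close> with values in \<open>{0, 1}\<close>.\<close>

definition tr :: "nat \<Rightarrow> 'k::field \<Rightarrow> 'k" where
  "tr m x = (\<Sum>j<m. x ^ (2 ^ j))"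

text \<open>The projective completion of the affine plane \<open>K\<close>: a parallel class of lines is represented
  by the one-dimensional \<open>F\<close>-subspace of \<open>K\<close> that is its common direction. Only those
  \<open>Infinite D\<close> for which \<open>D\<close> is such a subspace are points.\<close>

datatype 'k proj_point = Affine 'k | Infinite "'k set"

definition direction :: "'k::field set \<Rightarrow> 'k \<Rightarrow> 'k set" where
  "direction F d = {t * d | t. t \<in> F}"

definition line_at_infinity :: "'k::field set \<Rightarrow> 'k proj_point set" where
  "line_at_infinity F = {Infinite (direction F d) | d. d \<noteq> 0}"

definition proj_points :: "'k::field set \<Rightarrow> 'k proj_point set" where
  "proj_points F = range Affine \<union> line_at_infinity F"

definition completed_line :: "'k::field set \<Rightarrow> 'k \<Rightarrow> 'k \<Rightarrow> 'k proj_point set" where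
  "completed_line F a d = {Affine (a + t * d) | t. t \<in> F} \<union> {Infinite (direction F d)}"

definition proj_lines :: "'k::field set \<Rightarrow> 'k proj_point set set" where
  "proj_lines F = {completed_line F a d | a d. d \<noteq> 0} \<union> {line_at_infinity F}"

definition collinear3 ::
    "'k::field set \<Rightarrow> 'k proj_point \<Rightarrow> 'k proj_point \<Rightarrow> 'k proj_point \<Rightarrow> bool" where
  "collinear3 F A B C \<longleftrightarrow> (\<exists>l\<in>proj_lines F. A \<in> l \<and> B \<in> l \<and> C \<in> l)"

definition no_three_collinear :: "'k::field set \<Rightarrow> 'k proj_point set \<Rightarrow> bool" where
  "no_three_collinear F X \<longleftrightarrow>
     (\<forall>A\<in>X. \<forall>B\<in>X. \<forall>C\<in>X. A \<noteq> B \<and> A \<noteq> C \<and> B \<noteq> C \<longrightarrow> \<not> collinear3 F A B C)"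

definition is_oval :: "'k::field set \<Rightarrow> 'k proj_point set \<Rightarrow> bool" where
  "is_oval F X \<longleftrightarrow> X \<subseteq> proj_points F \<and> card X = card F + 1 \<and> no_three_collinear F X"

definition is_hyperoval :: "'k::field set \<Rightarrow> 'k proj_point set \<Rightarrow> bool" where
  "is_hyperoval F X \<longleftrightarrow> X \<subseteq> proj_points F \<and> card X = card F + 2 \<and> no_three_collinear F X"

definition is_tangent :: "'k::field set \<Rightarrow> 'k proj_point set \<Rightarrow> 'k proj_point set \<Rightarrow> bool" where
  "is_tangent F X l \<longleftrightarrow> l \<in> proj_lines F \<and> card (l \<inter> X) = 1"

definition is_nucleus :: "'k::field set \<Rightarrow> 'k proj_point set \<Rightarrow> 'k proj_point \<Rightarrow> bool" where
  "is_nucleus F X N \<longleftrightarrow> N \<in> proj_points F \<and> (\<forall>l. is_tangent F X l \<longrightarrow> N \<in> l)"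

definition is_hyperoval_in_K :: "'k::field set \<Rightarrow> 'k set \<Rightarrow> bool" where
  "is_hyperoval_in_K F H \<longleftrightarrow> is_hyperoval F (Affine ` H)"

definition is_oval_in_K_with_nucleus :: "'k::field set \<Rightarrow> 'k set \<Rightarrow> 'k \<Rightarrow> bool" where
  "is_oval_in_K_with_nucleus F X n \<longleftrightarrow>
     is_oval F (Affine ` X) \<and> is_nucleus F (Affine ` X) (Affine n)"

text \<open>\<open>is_niho_bent_of F m X f\<close> says that \<open>f\<close> is a Niho bent function associated with the oval
  \<open>X\<close> whose nucleus is the origin. Stated as a relation, so that existence and uniqueness of
  \<open>\<gamma>\<close> and of \<open>f\<close> are not presupposed. Bentness is a property of these
  functions and not part of their definition.\<close>

definition is_niho_bent_of ::
    "'k::field set \<Rightarrow> nat \<Rightarrow> 'k set \<Rightarrow> ('k \<Rightarrow> 'k) \<Rightarrow> bool" where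
  "is_niho_bent_of F m X f \<longleftrightarrow>
     is_oval_in_K_with_nucleus F X 0 \<and>
     f \<in> UNIV \<rightarrow> {0, 1} \<and>
     (\<exists>\<gamma>\<in>unit_circle F \<rightarrow> F - {0}.
        X = {u / \<gamma> u | u. u \<in> unit_circle F} \<and>
        (\<forall>c\<in>F. \<forall>u\<in>unit_circle F. f (c * u) = tr m (c * \<gamma> u)))"

definition translated_oval :: "'k::field set \<Rightarrow> ('k \<Rightarrow> 'k) \<Rightarrow> 'k \<Rightarrow> 'k set" where
  "translated_oval F g s =
     {v / g v + s / g s | v. v \<in> unit_circle F \<and> v \<noteq> s} \<union> {s / g s}"

end

theory Submission
  imports Defs "HOL-Computational_Algebra.Polynomial"
begin

text \<open>Translating the hyperoval \<open>\<H>\<close> by \<open>s / g(s)\<close> swaps \<open>0\<close> and \<open>s / g(s)\<close>, because the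
  characteristic is two, so \<open>\<O>\<^sub>s\<close> is a translate of \<open>\<H>\<close> without the origin; as every line meets
  a hyperoval in no or two points, the origin is its nucleus. Writing a point of \<open>\<O>\<^sub>s\<close> as
  \<open>w\<close>, the claimed polynomial is the sum of all \<open>(x / w) ^ (i (q - 1) + 2 ^ j)\<close>. For fixed \<open>w\<close> and
  \<open>j\<close>, the sum over \<open>i\<close> is a geometric sum of the \<open>(q + 1)\<close>-th root of unity \<open>(x / w) ^ (q - 1)\<close>, so
  it vanishes unless \<open>x / w\<close> is in \<open>F\<close>. For \<open>x = \<lambda> u\<close> this singles out \<open>w = u / \<gamma>(u)\<close> and
  leaves the trace of \<open>\<lambda> \<gamma>(u)\<close>.\<close>

section \<open>Field extension of degree two and its characteristic\<close>

locale quadratic_extension =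
  fixes F :: "'k::finite_field set" and q m :: nat
  assumes q_eq: "q = 2 ^ m"
    and card_K: "CARD('k) = q ^ 2"
    and subfield: "is_subfield F"
    and card_F: "card F = q"
begin

abbreviation S :: "'k set" where "S \<equiv> unit_circle F"

lemma zero_in: "0 \<in> F" and one_in: "1 \<in> F"
  and add_in: "x \<in> F \<Longrightarrow> y \<in> F \<Longrightarrow> x + y \<in> F"
  and mult_in: "x \<in> F \<Longrightarrow> y \<in> F \<Longrightarrow> x * y \<in> F"
  and minus_in: "x \<in> F \<Longrightarrow> - x \<in> F"
  and inverse_in: "x \<in> F \<Longrightarrow> inverse x \<in> F"
  using subfield unfolding is_subfield_def by auto

lemma diff_in: "x \<in> F \<Longrightarrow> y \<in> F \<Longrightarrow> x - y \<in> F"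
  using add_in[of x "- y"] minus_in by simp

lemma divide_in: "x \<in> F \<Longrightarrow> y \<in> F \<Longrightarrow> x / y \<in> F"
  using mult_in[of x "inverse y"] inverse_in by (simp add: divide_inverse)

lemma m_pos: "m > 0"
proof (rule ccontr)
  assume "\<not> m > 0"
  then have "CARD('k) = 1"
    using q_eq card_K by simp
  moreover have "card {0, 1 :: 'k} \<le> CARD('k)"
    by (rule card_mono) auto
  ultimately show False by simp
qed

lemma q_ge_2: "q \<ge> 2"
  using m_pos q_eq by (cases m) auto

lemma even_q: "even q"
  using m_pos q_eq by simp

text \<open>Every element is its own power with exponent \<open>CARD('k)\<close>, which is even; at
  \<open>-1\<close> this gives \<open>-1 = 1\<close>.\<close>

lemma char_two: "(1 :: 'k) + 1 = 0"
proof -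
  have "(-1 :: 'k) = (-1) ^ CARD('k)"
    by (rule finite_field_power_card_eq_same[symmetric])
  also have "\<dots> = 1"
    using even_q by (simp add: card_K)
  finally show ?thesis
    by (metis add.right_inverse)
qed

lemma double_eq_0: "(x :: 'k) + x = 0"
  using char_two by (metis distrib_left mult.right_neutral mult_zero_right)

lemma minus_eq_same: "- (x :: 'k) = x"
  using double_eq_0[of x] by (simp add: add_eq_0_iff)

lemma square_add_char_two: "(x + y :: 'k) ^ 2 = x ^ 2 + y ^ 2"
proof -
  have "(x + y) ^ 2 = x ^ 2 + y ^ 2 + (x * y + x * y)"
    by (simp add: power2_eq_square algebra_simps)
  then show ?thesis by (simp only: double_eq_0 add_0_right)
qed

section \<open>The subfield and the unit circle as sets of roots of unity\<close>

lemma card_power_eq_le: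
  fixes c :: 'k
  assumes "n > 0"
  shows "card {x. x ^ n = c} \<le> n"
proof -
  define p :: "'k poly" where "p = monom 1 n - [:c:]"
  have "coeff p n = 1"
    using assms by (cases n) (simp_all add: p_def)
  then have "p \<noteq> 0" by auto
  have "card {x. poly p x = 0} \<le> degree p"
    by (rule card_poly_roots_bound) fact
  also have "\<dots> \<le> n"
    unfolding p_def by (intro degree_diff_le) (auto simp: degree_monom_le)
  finally show ?thesis
    by (simp add: p_def poly_monom)
qed

text \<open>Multiplication by \<open>x\<close> permutes \<open>F - {0}\<close>, so the nonzero
  product of all its elements absorbs a factor \<open>x ^ (q - 1)\<close>.\<close>

lemma power_of_subfield:
  assumes "x \<in> F" "x \<noteq> 0"
  shows "x ^ (q - 1) = 1"
proof -
  have inj: "inj_on ((*) x) (F - {0})"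
    using assms by (auto intro: inj_onI)
  have "(*) x ` (F - {0}) \<subseteq> F - {0}"
    using assms mult_in by auto
  then have img: "(*) x ` (F - {0}) = F - {0}"
    by (intro card_subset_eq) (auto simp: card_image[OF inj])
  have "\<Prod>(F - {0}) = (\<Prod>y\<in>F - {0}. x * y)"
    using prod.reindex[OF inj, of "\<lambda>y. y"] img by (simp add: comp_def)
  also have "\<dots> = x ^ (q - 1) * \<Prod>(F - {0})"
    using zero_in by (simp add: prod.distrib card_F card_Diff_singleton)
  finally show ?thesis by simp
qed

text \<open>The \<open>q - 1\<close> nonzero elements of \<open>F\<close> are roots of an equation
  with at most \<open>q - 1\<close> roots, hence all of them.\<close>

lemma in_subfield_iff:
  assumes "x \<noteq> 0"
  shows "x \<in> F \<longleftrightarrow> x ^ (q - 1) = 1"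
proof -
  have sub: "F - {0} \<subseteq> {x. x ^ (q - 1) = 1}"
    using power_of_subfield by auto
  have "card {x :: 'k. x ^ (q - 1) = 1} \<le> card (F - {0})"
    using card_power_eq_le[of "q - 1"] q_ge_2 zero_in by (simp add: card_F)
  then have "F - {0} = {x. x ^ (q - 1) = 1}"
    using sub by (intro card_seteq) auto
  then show ?thesis using assms by blast
qed

lemma power_q_subfield:
  assumes "x \<in> F"
  shows "x ^ q = x"
proof (cases "x = 0")
  case True
  then show ?thesis using q_ge_2 by simp
next
  case False
  have "x ^ q = x * x ^ (q - 1)"
    using q_ge_2 by (cases q) auto
  then show ?thesis
    using power_of_subfield[OF assms False] by simp
qed

text \<open>\<open>x ^ (q - 1)\<close> is a complete invariant of the \<open>F\<close>-line through
  \<open>0\<close> and \<open>x\<close>; it turns incidence into equations between powers.\<close>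

lemma same_direction_iff:
  assumes "x \<noteq> 0" "y \<noteq> 0"
  shows "x / y \<in> F \<longleftrightarrow> x ^ (q - 1) = y ^ (q - 1)"
  using assms by (simp add: in_subfield_iff power_divide)

lemma unit_circle_iff: "u \<in> S \<longleftrightarrow> u ^ (q + 1) = 1"
  by (simp add: unit_circle_def bar_def card_F)

lemma unit_circle_nonzero: "u \<in> S \<Longrightarrow> u \<noteq> 0"
  by (auto simp: unit_circle_iff)

text \<open>The exponents multiply to \<open>(q - 1) * (q + 1) = q ^ 2 - 1\<close>, the order of the
  multiplicative group of \<open>K\<close>.\<close>

lemma power_in_unit_circle:
  assumes "x \<noteq> 0"
  shows "x ^ (q - 1) \<in> S"
proof -
  have "x * x ^ (CARD('k) - 1) = x ^ CARD('k)"
    using zero_less_card_finite[where 'a='k] by (cases "CARD('k)") auto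
  then have "x ^ (CARD('k) - 1) = 1"
    using assms by (simp add: finite_field_power_card_eq_same)
  moreover have "(q - 1) * (q + 1) = CARD('k) - 1"
    using q_ge_2 by (simp add: card_K power2_eq_square algebra_simps)
  ultimately show ?thesis
    by (simp add: unit_circle_iff del: power_Suc add: power_mult[symmetric])
qed

lemma card_unit_circle_le: "card S \<le> q + 1"
proof -
  have "S = {u. u ^ (q + 1) = 1}"
    using unit_circle_iff by blast
  then show ?thesis
    using card_power_eq_le[of "q + 1" 1] by simp
qed

text \<open>On the unit circle \<open>u ^ (q - 1) = u ^ (-2)\<close>, and squaring is injective.\<close>

lemma power_bij_unit_circle: "bij_betw (\<lambda>u. u ^ (q - 1)) S S"
proof -
  have "inj_on (\<lambda>u. u ^ (q - 1)) S"
  proof (rule inj_onI)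
    fix u v
    assume uv: "u \<in> S" "v \<in> S" "u ^ (q - 1) = v ^ (q - 1)"
    have *: "w ^ 2 * w ^ (q - 1) = 1" if "w \<in> S" for w
    proof -
      have "w ^ 2 * w ^ (q - 1) = w ^ (2 + (q - 1))"
        by (simp only: power_add)
      also have "2 + (q - 1) = q + 1"
        using q_ge_2 by simp
      finally show ?thesis using that unit_circle_iff by simp
    qed
    have "u ^ 2 = v ^ 2"
      using *[OF uv(1)] *[OF uv(2)] uv(3) by (metis mult_cancel_right zero_neq_one mult_zero_right)
    then have "(u + v) ^ 2 = 0"
      by (simp add: square_add_char_two double_eq_0)
    then have "u + v = 0" by simp
    then show "u = v" by (metis minus_eq_same add_eq_0_iff)
  qed
  moreover have "(\<lambda>u. u ^ (q - 1)) ` S \<subseteq> S"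
    using power_in_unit_circle unit_circle_nonzero by auto
  ultimately show ?thesis
    unfolding bij_betw_def by (simp add: endo_inj_surj)
qed

text \<open>As \<open>u ^ (q - 1)\<close> runs over all of \<open>S\<close>, some \<open>u\<close>
  in \<open>S\<close> has the same direction as a nonzero \<open>x\<close>; then
  \<open>c = x / u\<close> lies in \<open>F\<close>.\<close>

lemma polar_decomposition:
  obtains c u where "c \<in> F" "u \<in> S" "x = c * u"
proof (cases "x = 0")
  case True
  have "1 \<in> S" by (simp add: unit_circle_iff)
  then show ?thesis using that[of 0 1] zero_in True by simp
next
  case False
  obtain u where u: "u \<in> S" "u ^ (q - 1) = x ^ (q - 1)"
    using power_in_unit_circle[OF False] power_bij_unit_circle
    by (metis (no_types, lifting) bij_betw_def imageE)
  then have "x / u \<in> F"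
    using False unit_circle_nonzero by (simp add: same_direction_iff)
  then show ?thesis
    using that[of "x / u" u] u unit_circle_nonzero by simp
qed

section \<open>The trace and geometric sums of roots of unity\<close>

text \<open>Squaring shifts the summands cyclically because \<open>x ^ q = x\<close>, so the trace
  is a root of \<open>y ^ 2 = y\<close>.\<close>

lemma trace_in_prime_field:
  assumes "x \<in> F"
  shows "tr m x \<in> {0, 1}"
proof -
  have square_sum: "(\<Sum>j<n. f j) ^ 2 = (\<Sum>j<n. f j ^ 2)" for f :: "nat \<Rightarrow> 'k" and n
    by (induction n) (simp_all add: square_add_char_two)
  have "(tr m x) ^ 2 = (\<Sum>j<m. x ^ (2 ^ Suc j))"
    unfolding tr_def square_sum by (simp add: power_mult[symmetric] mult.commute)
  \<comment> \<open>The sum of \<open>m + 1\<close> terms is split in two ways: its first term is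
    \<open>x\<close>, its last is \<open>x ^ q = x\<close>.\<close>
  moreover have "(\<Sum>j<m. x ^ (2 ^ Suc j)) + x = (\<Sum>j<Suc m. x ^ (2 ^ j))"
    by (subst sum.lessThan_Suc_shift) simp
  moreover have "(\<Sum>j<Suc m. x ^ (2 ^ j)) = tr m x + x"
    using power_q_subfield[OF assms] by (simp add: tr_def q_eq)
  ultimately have "(tr m x) ^ 2 = tr m x" by simp
  then show ?thesis
    by (simp add: power2_eq_square)
qed

text \<open>With \<open>y = (x / w) ^ (q - 1)\<close> the double sum factors into the sum of the
  \<open>y ^ i\<close> and the trace expression in \<open>x / w\<close>. Since
  \<open>y ^ (q + 1) = 1\<close>, the first factor vanishes unless \<open>y = 1\<close>.\<close>

lemma trace_mult_expand:
  assumes "x \<noteq> 0" "w \<noteq> 0"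
  shows "(\<Sum>j<m. \<Sum>i\<le>q. (x / w) ^ (i * (q - 1) + 2 ^ j)) = (if x / w \<in> F then tr m (x / w) else 0)"
proof -
  define y where "y = (x / w) ^ (q - 1)"
  have "y \<in> S"
    unfolding y_def using assms by (intro power_in_unit_circle) simp
  then have y: "y ^ Suc q = 1"
    by (simp add: unit_circle_iff)
  \<comment> \<open>For \<open>y = 1\<close> there are \<open>q + 1\<close> summands equal to one;
    \<open>q\<close> is even, so they add up to one.\<close>
  obtain k where "q = k + k"
    using even_q by (auto simp: mult_2)
  then have of_nat_q: "(of_nat q :: 'k) = 0"
    by (simp only: of_nat_add double_eq_0)
  have "(\<Sum>i\<le>q. y ^ i) = (if y = 1 then 1 else 0)"
  proof (cases "y = 1")
    case True
    then show ?thesis by (simp add: of_nat_q)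
  next
    case False
    then show ?thesis
      using geometric_sum[of y "Suc q"] y by (simp only: lessThan_Suc_atMost) simp
  qed
  moreover have "x / w \<in> F \<longleftrightarrow> y = 1"
    unfolding y_def using assms by (intro in_subfield_iff) simp
  moreover have "(\<Sum>j<m. \<Sum>i\<le>q. (x / w) ^ (i * (q - 1) + 2 ^ j)) = (\<Sum>i\<le>q. y ^ i) * tr m (x / w)"
  proof -
    have "(x / w) ^ (i * (q - 1) + 2 ^ j) = y ^ i * (x / w) ^ 2 ^ j" for i j
      by (simp only: y_def power_add power_mult[symmetric] mult.commute[of i])
    then show ?thesis
      unfolding tr_def sum_product by (subst sum.swap) simp
  qed
  ultimately show ?thesis by simp
qed

section \<open>Collinearity expressed by powers of differences\<close>

lemma collinear3_affine_iff:
  assumes "a \<noteq> b" "a \<noteq> c"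
  shows "collinear3 F (Affine a) (Affine b) (Affine c) \<longleftrightarrow>
    (b - a) ^ (q - 1) = (c - a) ^ (q - 1)"
proof -
  have nz: "b - a \<noteq> 0" "c - a \<noteq> 0" using assms by auto
  show ?thesis
    unfolding same_direction_iff[OF nz, symmetric]
  proof
    assume "collinear3 F (Affine a) (Affine b) (Affine c)"
    then obtain l where l: "l \<in> proj_lines F" "Affine a \<in> l" "Affine b \<in> l" "Affine c \<in> l"
      by (auto simp: collinear3_def)
    \<comment> \<open>The line at infinity is excluded, as it contains no affine point.\<close>
    then obtain p d where "d \<noteq> 0" "l = completed_line F p d"
      by (auto simp: proj_lines_def line_at_infinity_def)
    then obtain r t u where *: "r \<in> F" "t \<in> F" "u \<in> F"
        "a = p + r * d" "b = p + t * d" "c = p + u * d"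
      using l by (auto simp: completed_line_def)
    then have "(b - a) / (c - a) = ((t - r) * d) / ((u - r) * d)"
      by (simp add: algebra_simps)
    also have "\<dots> = (t - r) / (u - r)"
      using \<open>d \<noteq> 0\<close> by simp
    finally show "(b - a) / (c - a) \<in> F"
      using * diff_in divide_in by simp
  next
    assume *: "(b - a) / (c - a) \<in> F"
    \<comment> \<open>On the line through \<open>a\<close> with direction \<open>c - a\<close>, the
      parameters of \<open>b\<close>, \<open>a\<close>, \<open>c\<close> are the given quotient,
      \<open>0\<close> and \<open>1\<close>, all in \<open>F\<close>.\<close>
    have "b = a + (b - a) / (c - a) * (c - a)" "a = a + 0 * (c - a)" "c = a + 1 * (c - a)"
      using nz by auto
    then have "Affine x \<in> completed_line F a (c - a)" if "x \<in> {a, b, c}" for x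
      using that * zero_in one_in unfolding completed_line_def
      by (metis (mono_tags, lifting) UnI1 empty_iff insert_iff mem_Collect_eq)
    moreover have "completed_line F a (c - a) \<in> proj_lines F"
      using nz(2) unfolding proj_lines_def by blast
    ultimately show "collinear3 F (Affine a) (Affine b) (Affine c)"
      unfolding collinear3_def by blast
  qed
qed

text \<open>Two further points are collinear with \<open>a\<close> exactly when they are seen from
  \<open>a\<close> in the same direction.\<close>

lemma no_three_collinear_affine_iff:
  "no_three_collinear F (Affine ` X) \<longleftrightarrow>
    (\<forall>a\<in>X. inj_on (\<lambda>b. (b - a) ^ (q - 1)) (X - {a}))"
    (is "?L \<longleftrightarrow> ?R")
proof
  assume L: ?L
  show ?R
  proof (intro ballI inj_onI, rule ccontr)
    fix a b c
    assume *: "a \<in> X" "b \<in> X - {a}" "c \<in> X - {a}" "(b - a) ^ (q - 1) = (c - a) ^ (q - 1)" "b \<noteq> c"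
    then have "collinear3 F (Affine a) (Affine b) (Affine c)"
      by (subst collinear3_affine_iff) auto
    then show False
      using L * unfolding no_three_collinear_def by auto
  qed
next
  assume R: ?R
  have "\<not> collinear3 F (Affine a) (Affine b) (Affine c)"
    if *: "a \<in> X" "b \<in> X" "c \<in> X" "a \<noteq> b" "a \<noteq> c" "b \<noteq> c" for a b c
  proof -
    have "inj_on (\<lambda>b. (b - a) ^ (q - 1)) (X - {a})"
      using R * by blast
    then have "(b - a) ^ (q - 1) \<noteq> (c - a) ^ (q - 1)"
      using * by (auto dest: inj_onD)
    then show ?thesis
      using collinear3_affine_iff * by simp
  qed
  then show ?L
    unfolding no_three_collinear_def by blast
qed

lemma is_hyperoval_in_K_iff:
  "is_hyperoval_in_K F H \<longleftrightarrow>
    card H = q + 2 \<and> (\<forall>a\<in>H. inj_on (\<lambda>b. (b - a) ^ (q - 1)) (H - {a}))"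
proof -
  have "card (Affine ` H) = card H"
    by (rule card_image) (auto intro: inj_onI)
  then show ?thesis
    unfolding is_hyperoval_in_K_def is_hyperoval_def no_three_collinear_affine_iff
    by (auto simp: proj_points_def card_F)
qed

lemma is_oval_affine_iff:
  "is_oval F (Affine ` X) \<longleftrightarrow>
    card X = q + 1 \<and> (\<forall>a\<in>X. inj_on (\<lambda>b. (b - a) ^ (q - 1)) (X - {a}))"
proof -
  have "card (Affine ` X) = card X"
    by (rule card_image) (auto intro: inj_onI)
  then show ?thesis
    unfolding is_oval_def no_three_collinear_affine_iff
    by (auto simp: proj_points_def card_F)
qed

section \<open>Directions and nuclei of hyperovals\<close>

lemma hyperoval_translate:
  assumes "is_hyperoval_in_K F H"
  shows "is_hyperoval_in_K F ((\<lambda>x. x + c) ` H)"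
proof -
  have "card ((\<lambda>x. x + c) ` H) = card H"
    by (rule card_image) (auto intro: inj_onI)
  moreover have "inj_on (\<lambda>b. (b - p) ^ (q - 1)) ((\<lambda>x. x + c) ` H - {p})"
    if p: "p \<in> (\<lambda>x. x + c) ` H" for p
  proof -
    obtain a where a: "a \<in> H" "p = a + c" using p by auto
    then have "inj_on (\<lambda>b. (b - a) ^ (q - 1)) (H - {a})"
      using assms is_hyperoval_in_K_iff by blast
    then have "inj_on ((\<lambda>b. (b - p) ^ (q - 1)) \<circ> (\<lambda>x. x + c)) (H - {a})"
      using a by (simp add: comp_def)
    then have "inj_on (\<lambda>b. (b - p) ^ (q - 1)) ((\<lambda>x. x + c) ` (H - {a}))"
      by (rule inj_on_imageI)
    moreover have "(\<lambda>x. x + c) ` (H - {a}) = (\<lambda>x. x + c) ` H - {p}"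
      using a by auto
    ultimately show ?thesis by simp
  qed
  ultimately show ?thesis
    using assms unfolding is_hyperoval_in_K_iff by metis
qed

text \<open>The \<open>q + 1\<close> other points lie in distinct directions from \<open>p\<close>,
  and \<open>S\<close> has at most \<open>q + 1\<close> elements, so every direction occurs.
  Geometrically, each line through \<open>p\<close> meets \<open>H\<close> in exactly one more
  point.\<close>

lemma hyperoval_directions_bij:
  assumes "is_hyperoval_in_K F H" "p \<in> H"
  shows "bij_betw (\<lambda>h. (h - p) ^ (q - 1)) (H - {p}) S"
proof -
  have inj: "inj_on (\<lambda>h. (h - p) ^ (q - 1)) (H - {p})"
    using assms by (auto simp: is_hyperoval_in_K_iff)
  have sub: "(\<lambda>h. (h - p) ^ (q - 1)) ` (H - {p}) \<subseteq> S"
    by (intro image_subsetI power_in_unit_circle) auto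
  have "card S \<le> card ((\<lambda>h. (h - p) ^ (q - 1)) ` (H - {p}))"
    unfolding card_image[OF inj] using card_unit_circle_le assms
    by (simp add: is_hyperoval_in_K_iff)
  then show ?thesis
    using inj sub unfolding bij_betw_def by (intro conjI card_seteq) auto
qed

text \<open>A tangent at \<open>p\<close> that missed \<open>n\<close> would contain a second point
  of \<open>H\<close>, since \<open>H\<close> is seen from \<open>p\<close> in every direction. That
  point is not \<open>n\<close>, so the line would meet the oval twice.\<close>

lemma oval_of_hyperoval:
  assumes H: "is_hyperoval_in_K F H" and n: "n \<in> H"
  shows "is_oval_in_K_with_nucleus F (H - {n}) n"
proof -
  have "is_oval F (Affine ` (H - {n}))"
    using H n unfolding is_oval_affine_iff is_hyperoval_in_K_iff
    by (auto intro: inj_on_subset)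
  moreover have "Affine n \<in> l" if tangent: "is_tangent F (Affine ` (H - {n})) l" for l
  proof (rule ccontr)
    assume notin: "Affine n \<notin> l"
    have "card (l \<inter> Affine ` (H - {n})) = 1"
      using tangent by (simp add: is_tangent_def)
    then obtain P where "l \<inter> Affine ` (H - {n}) = {P}"
      by (rule card_1_singletonE)
    then obtain p where p: "l \<inter> Affine ` (H - {n}) = {Affine p}" by auto
    then have pl: "Affine p \<in> l" "p \<in> H" by auto
    obtain a d where l: "d \<noteq> 0" "l = completed_line F a d"
      using tangent pl by (auto simp: is_tangent_def proj_lines_def line_at_infinity_def)
    obtain t where t: "t \<in> F" "p = a + t * d"
      using pl l by (auto simp: completed_line_def)
    \<comment> \<open>The second point \<open>h\<close> is the one seen from \<open>p\<close> in the
      direction \<open>d\<close> of the tangent.\<close>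
    have "d ^ (q - 1) \<in> (\<lambda>h. (h - p) ^ (q - 1)) ` (H - {p})"
      using hyperoval_directions_bij[OF H pl(2)] power_in_unit_circle[OF l(1)]
      by (simp add: bij_betw_def)
    then obtain h where h: "h \<in> H" "h \<noteq> p" "(h - p) ^ (q - 1) = d ^ (q - 1)"
      unfolding image_iff by (metis DiffE insertI1)
    then have r: "(h - p) / d \<in> F"
      using l by (simp add: same_direction_iff)
    have "h = a + (t + (h - p) / d) * d"
      using l t by (simp add: distrib_right)
    then have "Affine h \<in> l"
      using add_in[OF t(1) r] l unfolding completed_line_def by blast
    moreover from this have "h \<noteq> n" using notin by auto
    ultimately have "Affine h \<in> l \<inter> Affine ` (H - {n})"
      using h by auto
    then show False using p h by auto
  qed
  ultimately show ?thesis
    unfolding is_oval_in_K_with_nucleus_def is_nucleus_def by (auto simp: proj_points_def)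
qed

section \<open>Niho functions as polynomials\<close>

text \<open>By \<open>bij\<close>, each \<open>u\<close> in \<open>S\<close> has a unique point
  \<open>pt u\<close> of \<open>X\<close> in its direction; the witness is
  \<open>\<gamma> u = u / pt u\<close>.\<close>

lemma oval_polar_form:
  assumes bij: "bij_betw (\<lambda>w. w ^ (q - 1)) X S" and "0 \<notin> X"
  obtains \<gamma> where "\<gamma> \<in> S \<rightarrow> F - {0}" "X = {u / \<gamma> u | u. u \<in> S}"
proof -
  define pt where "pt u = the_inv_into X (\<lambda>w. w ^ (q - 1)) (u ^ (q - 1))" for u
  have inj: "inj_on (\<lambda>w. w ^ (q - 1)) X" and img: "(\<lambda>w. w ^ (q - 1)) ` X = S"
    using bij by (auto simp: bij_betw_def)
  have pt: "pt u \<in> X" "pt u ^ (q - 1) = u ^ (q - 1)" "pt u \<noteq> 0" if "u \<in> S" for u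
  proof -
    have "u ^ (q - 1) \<in> (\<lambda>w. w ^ (q - 1)) ` X"
      using that img power_in_unit_circle unit_circle_nonzero by simp
    from the_inv_into_into[OF inj this subset_refl] f_the_inv_into_f[OF inj this]
    show "pt u \<in> X" "pt u ^ (q - 1) = u ^ (q - 1)"
      by (simp_all add: pt_def)
    then show "pt u \<noteq> 0" using \<open>0 \<notin> X\<close> by auto
  qed
  have "w \<in> pt ` S" if "w \<in> X" for w
  proof -
    have "w ^ (q - 1) \<in> S" using that img by auto
    then obtain u where "u \<in> S" "u ^ (q - 1) = w ^ (q - 1)"
      using power_bij_unit_circle by (metis (no_types, lifting) bij_betw_def imageE)
    then show ?thesis
      using inj_onD[OF inj, of "pt u" w] pt that by auto
  qed
  then have "X = pt ` S" using pt by auto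
  also have "\<dots> = {u / (u / pt u) | u. u \<in> S}"
    using unit_circle_nonzero by force
  finally have "X = {u / (u / pt u) | u. u \<in> S}" .
  moreover have "(\<lambda>u. u / pt u) \<in> S \<rightarrow> F - {0}"
    using pt same_direction_iff unit_circle_nonzero by auto
  ultimately show ?thesis
    using that[of "\<lambda>u. u / pt u"] by blast
qed

text \<open>For \<open>c \<noteq> 0\<close> only \<open>w = u / \<gamma> u\<close> makes
  \<open>c * u / w\<close> an element of \<open>F\<close>, and there the quotient is
  \<open>c * \<gamma> u\<close>.\<close>

lemma niho_expand:
  assumes \<gamma>: "\<gamma> \<in> S \<rightarrow> F - {0}" and c: "c \<in> F" and u: "u \<in> S"
  defines "X \<equiv> {u / \<gamma> u | u. u \<in> S}"
  shows "(\<Sum>j<m. \<Sum>i\<le>q. \<Sum>w\<in>X. (c * u / w) ^ (i * (q - 1) + 2 ^ j)) = tr m (c * \<gamma> u)"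
proof (cases "c = 0")
  case True
  \<comment> \<open>All exponents are at least \<open>2 ^ j > 0\<close>, so every power of zero
    vanishes.\<close>
  then show ?thesis by (simp add: tr_def power_0_left)
next
  case False
  have nz: "c * u \<noteq> 0" using False u unit_circle_nonzero by simp
  have \<gamma>': "\<gamma> v \<in> F" "\<gamma> v \<noteq> 0" if "v \<in> S" for v
    using \<gamma> that by auto
  have quot: "c * u / (v / \<gamma> v) \<in> F \<longleftrightarrow> v = u" if v: "v \<in> S" for v
  proof -
    have "v \<noteq> 0" "u \<noteq> 0" using u v unit_circle_nonzero by auto
    then have "c * u / (v / \<gamma> v) \<in> F \<longleftrightarrow> (c * u) ^ (q - 1) = (v / \<gamma> v) ^ (q - 1)"
      using nz \<gamma>'[OF v] by (intro same_direction_iff) auto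
    \<comment> \<open>The factors \<open>c\<close> and \<open>\<gamma> v\<close> drop out, being
      nonzero elements of \<open>F\<close>.\<close>
    also have "\<dots> \<longleftrightarrow> u ^ (q - 1) = v ^ (q - 1)"
      using power_of_subfield[OF c False] power_of_subfield[OF \<gamma>'[OF v]]
      by (simp add: power_mult_distrib power_divide)
    also have "\<dots> \<longleftrightarrow> v = u"
      using bij_betw_imp_inj_on[OF power_bij_unit_circle] u v by (auto dest: inj_onD)
    finally show ?thesis .
  qed
  have X_nz: "w \<noteq> 0" if "w \<in> X" for w
    using that \<gamma>' unit_circle_nonzero by (auto simp: X_def)
  have X_iff: "c * u / w \<in> F \<longleftrightarrow> w = u / \<gamma> u" if w: "w \<in> X" for w
  proof -
    obtain v where v: "v \<in> S" "w = v / \<gamma> v"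
      using w by (auto simp: X_def)
    show ?thesis
    proof
      assume "c * u / w \<in> F"
      then show "w = u / \<gamma> u" using quot v by blast
    next
      assume "w = u / \<gamma> u"
      then show "c * u / w \<in> F" using quot[OF u] by blast
    qed
  qed
  have "(\<Sum>j<m. \<Sum>i\<le>q. \<Sum>w\<in>X. (c * u / w) ^ (i * (q - 1) + 2 ^ j))
      = (\<Sum>j<m. \<Sum>w\<in>X. \<Sum>i\<le>q. (c * u / w) ^ (i * (q - 1) + 2 ^ j))"
    by (rule sum.cong[OF refl], rule sum.swap)
  also have "\<dots> = (\<Sum>w\<in>X. \<Sum>j<m. \<Sum>i\<le>q. (c * u / w) ^ (i * (q - 1) + 2 ^ j))"
    by (rule sum.swap)
  also have "\<dots> = (\<Sum>w\<in>X. if w = u / \<gamma> u then tr m (c * u / w) else 0)"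
    using nz X_nz X_iff by (intro sum.cong refl, subst trace_mult_expand) auto
  also have "\<dots> = tr m (c * u / (u / \<gamma> u))"
    using u by (subst sum.delta) (auto simp: X_def)
  also have "c * u / (u / \<gamma> u) = c * \<gamma> u"
    using u unit_circle_nonzero by simp
  finally show ?thesis .
qed

text \<open>The equivalence yields existence, uniqueness and the formula at once. Whatever
  \<open>\<gamma>\<close> is used, the polar decomposition fixes \<open>f\<close> everywhere;
  conversely the polynomial takes trace values, which lie in \<open>{0, 1}\<close>.\<close>

lemma niho_polynomial_iff:
  assumes oval: "is_oval_in_K_with_nucleus F X 0"
    and bij: "bij_betw (\<lambda>w. w ^ (q - 1)) X S" and "0 \<notin> X"
  shows "is_niho_bent_of F m X f \<longleftrightarrow>
    f = (\<lambda>x. \<Sum>j<m. \<Sum>i\<le>q. \<Sum>w\<in>X. (x / w) ^ (i * (q - 1) + 2 ^ j))"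
    (is "_ \<longleftrightarrow> f = ?P")
proof
  assume "is_niho_bent_of F m X f"
  then obtain \<gamma> where \<gamma>: "\<gamma> \<in> S \<rightarrow> F - {0}" "X = {u / \<gamma> u | u. u \<in> S}"
      "\<And>c u. c \<in> F \<Longrightarrow> u \<in> S \<Longrightarrow> f (c * u) = tr m (c * \<gamma> u)"
    by (auto simp: is_niho_bent_of_def)
  show "f = ?P"
  proof
    fix x
    obtain c u where "c \<in> F" "u \<in> S" "x = c * u" by (rule polar_decomposition)
    then show "f x = ?P x"
      using niho_expand[OF \<gamma>(1), folded \<gamma>(2)] \<gamma>(3) by simp
  qed
next
  assume f: "f = ?P"
  obtain \<gamma> where \<gamma>: "\<gamma> \<in> S \<rightarrow> F - {0}" "X = {u / \<gamma> u | u. u \<in> S}"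
    using bij \<open>0 \<notin> X\<close> by (rule oval_polar_form)
  have val: "f (c * u) = tr m (c * \<gamma> u)" if "c \<in> F" "u \<in> S" for c u
    using niho_expand[OF \<gamma>(1) that, folded \<gamma>(2)] f by simp
  have "f x \<in> {0, 1}" for x
  proof -
    obtain c u where x: "c \<in> F" "u \<in> S" "x = c * u" by (rule polar_decomposition)
    then have "c * \<gamma> u \<in> F" using \<gamma>(1) mult_in by auto
    then show ?thesis
      using val x trace_in_prime_field by simp
  qed
  then show "is_niho_bent_of F m X f"
    unfolding is_niho_bent_of_def using oval \<gamma> val by blast
qed

section \<open>The translated oval and its coefficients\<close>

text \<open>The translation exchanges \<open>0\<close> and \<open>s / g s\<close>. No other point is
  sent to \<open>0\<close>, since \<open>v / g v = s / g s\<close> forces \<open>v\<close> and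
  \<open>s\<close> to have equal directions and hence \<open>v = s\<close>.\<close>

lemma translated_oval_eq:
  assumes g: "g \<in> S \<rightarrow> F - {0}" and s: "s \<in> S"
  shows "translated_oval F g s =
    (\<lambda>x. x + s / g s) ` ({u / g u | u. u \<in> S} \<union> {0}) - {0}"
proof -
  have nz: "v \<noteq> 0" "g v \<noteq> 0" "g v \<in> F" if "v \<in> S" for v
    using g that unit_circle_nonzero by auto
  have inj: "v = s" if v: "v \<in> S" and eq: "v / g v + s / g s = 0" for v
  proof -
    have "v / g v = s / g s"
      using eq by (metis minus_eq_same add_eq_0_iff)
    then have "(v / g v) ^ (q - 1) = (s / g s) ^ (q - 1)" by simp
    then have "v ^ (q - 1) = s ^ (q - 1)"
      using power_of_subfield nz[OF v] nz[OF s] by (simp add: power_divide)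
    then show ?thesis
      using bij_betw_imp_inj_on[OF power_bij_unit_circle] s v by (auto dest: inj_onD)
  qed
  show ?thesis
  proof (intro set_eqI iffI)
    fix x assume "x \<in> translated_oval F g s"
    then show "x \<in> (\<lambda>x. x + s / g s) ` ({u / g u | u. u \<in> S} \<union> {0}) - {0}"
      unfolding translated_oval_def using inj nz[OF s] by auto
  next
    fix x assume "x \<in> (\<lambda>x. x + s / g s) ` ({u / g u | u. u \<in> S} \<union> {0}) - {0}"
    then have "x \<noteq> 0" "x = s / g s \<or> (\<exists>u\<in>S. x = u / g u + s / g s)" by auto
    moreover have "s / g s + s / g s = 0" by (rule double_eq_0)
    ultimately show "x \<in> translated_oval F g s"
      unfolding translated_oval_def by blast
  qed
qed

text \<open>Clearing denominators in \<open>v / g v + s / g s\<close> produces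
  \<open>g s * v + s * g v\<close>. Powers of values of \<open>g\<close> lose the part
  \<open>i * (q - 1)\<close> of the exponent, because these values are nonzero elements of
  \<open>F\<close>.\<close>

lemma sum_translated_oval:
  assumes g: "g \<in> S \<rightarrow> F - {0}" and s: "s \<in> S"
  shows "(\<Sum>w\<in>translated_oval F g s. (x / w) ^ (i * (q - 1) + 2 ^ j)) =
    (g s ^ (2 ^ j) / s ^ (i * (q - 1) + 2 ^ j) +
     (\<Sum>v \<in> S - {s}.
        g s ^ (2 ^ j) * g v ^ (2 ^ j) / (g s * v + s * g v) ^ (i * (q - 1) + 2 ^ j)))
    * x ^ (i * (q - 1) + 2 ^ j)"
proof -
  define e where "e = i * (q - 1) + 2 ^ j"
  define pt where "pt v = v / g v + s / g s" for v
  have nz: "v \<noteq> 0" "g v \<noteq> 0" "g v \<in> F" if "v \<in> S" for v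
    using g that unit_circle_nonzero by auto
  have g_power: "g v ^ e = g v ^ (2 ^ j)" if "v \<in> S" for v
  proof -
    have "g v ^ e = (g v ^ (q - 1)) ^ i * g v ^ (2 ^ j)"
      by (simp add: e_def power_add power_mult[symmetric] mult.commute)
    then show ?thesis using power_of_subfield nz[OF that] by simp
  qed
  have set_eq: "translated_oval F g s = insert (s / g s) (pt ` (S - {s}))"
    by (auto simp: translated_oval_def pt_def)
  have "inj_on pt (S - {s})"
  proof (rule inj_onI)
    fix u v assume uv: "u \<in> S - {s}" "v \<in> S - {s}" "pt u = pt v"
    then have "(u / g u) ^ (q - 1) = (v / g v) ^ (q - 1)" by (simp add: pt_def)
    then have "u ^ (q - 1) = v ^ (q - 1)"
      using power_of_subfield nz[of u] nz[of v] uv by (simp add: power_divide)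
    then show "u = v"
      using bij_betw_imp_inj_on[OF power_bij_unit_circle] uv by (auto dest: inj_onD)
  qed
  \<comment> \<open>Equality with some \<open>pt v\<close> would give
    \<open>v / g v = 0\<close>.\<close>
  moreover have "s / g s \<notin> pt ` (S - {s})"
    using nz by (auto simp: pt_def)
  ultimately have "(\<Sum>w\<in>translated_oval F g s. (x / w) ^ e) =
      (x / (s / g s)) ^ e + (\<Sum>v\<in>S - {s}. (x / pt v) ^ e)"
    unfolding set_eq by (simp add: sum.reindex)
  also have "(x / (s / g s)) ^ e = g s ^ (2 ^ j) / s ^ e * x ^ e"
    by (simp add: power_mult_distrib power_divide g_power[OF s])
  also have "(\<Sum>v\<in>S - {s}. (x / pt v) ^ e) =
      (\<Sum>v\<in>S - {s}. g s ^ (2 ^ j) * g v ^ (2 ^ j) / (g s * v + s * g v) ^ e * x ^ e)"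
  proof (rule sum.cong[OF refl])
    fix v assume v: "v \<in> S - {s}"
    have "pt v = (g s * v + s * g v) / (g s * g v)"
      using nz[OF s] nz[of v] v by (simp add: pt_def field_simps)
    then show "(x / pt v) ^ e = g s ^ (2 ^ j) * g v ^ (2 ^ j) / (g s * v + s * g v) ^ e * x ^ e"
      using v by (simp add: power_mult_distrib power_divide g_power[OF s] g_power)
  qed
  finally show ?thesis
    by (simp add: e_def distrib_right sum_distrib_right)
qed

end

theorem theorem3p8:
  fixes F :: "'k::finite_field set" and m q :: nat and g :: "'k \<Rightarrow> 'k" and s :: 'k
  assumes "q = 2 ^ m"
    and "CARD('k) = q ^ 2"
    and "is_subfield F" and "card F = q"
    and "g \<in> unit_circle F \<rightarrow> F - {0}"
    and "is_hyperoval_in_K F ({u / g u | u. u \<in> unit_circle F} \<union> {0})"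
    and "s \<in> unit_circle F"
  shows "is_oval_in_K_with_nucleus F (translated_oval F g s) 0 \<and>
    (\<exists>!f. is_niho_bent_of F m (translated_oval F g s) f) \<and>
    (\<forall>f. is_niho_bent_of F m (translated_oval F g s) f \<longrightarrow>
      (\<forall>x. f x =
        (\<Sum>j = 0..m - 1. \<Sum>i = 0..q.
          (g s ^ (2 ^ j) / s ^ (i * (q - 1) + 2 ^ j) +
           (\<Sum>v \<in> unit_circle F - {s}.
              g s ^ (2 ^ j) * g v ^ (2 ^ j) / (g s * v + s * g v) ^ (i * (q - 1) + 2 ^ j)))
          * x ^ (i * (q - 1) + 2 ^ j))))"
proof -
  interpret quadratic_extension F q m
    using assms by unfold_locales auto
  let ?O = "translated_oval F g s"
  let ?H = "(\<lambda>x. x + s / g s) ` ({u / g u | u. u \<in> S} \<union> {0})"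
  have O_eq: "?O = ?H - {0}"
    by (rule translated_oval_eq) fact+
  have H: "is_hyperoval_in_K F ?H"
    using assms(6) by (rule hyperoval_translate)
  \<comment> \<open>The origin lies in the translate as the image of \<open>s / g s\<close>.\<close>
  have "s / g s + s / g s = 0" by (rule double_eq_0)
  then have 0: "0 \<in> ?H"
    using assms(7) by (intro image_eqI[where x = "s / g s"]) auto
  have oval: "is_oval_in_K_with_nucleus F ?O 0"
    unfolding O_eq by (rule oval_of_hyperoval[OF H 0])
  \<comment> \<open>These are the directions of the remaining points as seen from the hyperoval
    point \<open>0\<close>.\<close>
  have bij: "bij_betw (\<lambda>w. w ^ (q - 1)) ?O S"
    using hyperoval_directions_bij[OF H 0] unfolding O_eq by simp
  have niho: "is_niho_bent_of F m ?O f \<longleftrightarrow>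
      f = (\<lambda>x. \<Sum>j<m. \<Sum>i\<le>q. \<Sum>w\<in>?O. (x / w) ^ (i * (q - 1) + 2 ^ j))" for f
    by (rule niho_polynomial_iff[OF oval bij]) (simp add: O_eq)
  \<comment> \<open>Truncated subtraction makes \<open>m > 0\<close> essential here: for
    \<open>m = 0\<close> the left set would be \<open>{0}\<close>.\<close>
  have "{0..m - 1} = {..<m}" "{0..q} = {..q}"
    using m_pos by auto
  then show ?thesis
    using oval unfolding niho sum_translated_oval[OF assms(5,7)] by simp
qed

end
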